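(* Let $L,n\in\mathbb N$, $n\ge5$, $L\ge 6(n-1)$. Let $\mathbf V\subset A_n^L$ be a set of $3n$ distinct words, partitioned into $n$ three-element sets $\mathbf V_a=\{v_{a,1},v_{a,2},v_{a,3}\}$, $a\in A_n$. Put $\varepsilon=\frac{\mathbf l(\mathbf V)+\mathbf r(\mathbf V)}{L-1}$ and suppose: (1) $\mathrm{per}(v)=|v|=L$ for all $v\in\mathbf V$; (2) $uv\in\mathbf D^{\varepsilon}_{3,n}\cap\mathbf T_n$ for any two distinct $u,v\in\mathbf V$; (3) for every $a\in A_n$, all $v,v'\in\mathbf V_a$ and all $u\ne w$ in $\mathbf V\setminus\mathbf V_a$, $$\varepsilon+\max\{\,l+r:\ \mathrm{pref}_l(u)=\mathrm{pref}_l(v),\ \mathrm{suff}_r(v')=\mathrm{suff}_r(w)\,\}\le\frac{L}{n-1}.$$ Define the context-dependent substitution by $f_w(\lambda)=\lambda$ for all $w\in A_n^*$ and $$f_u(av)=v_{a,i}\,f_{ua}(v),\qquad i=\big((|ua|_a-1)\bmod 3\big)+1,\qquad a\in A_n,\ u,v\in A_n^*.$$ Then for every word $w\in\mathbf D^{\varepsilon}_{3,n}\cap\mathbf T_n$ one has $f_\lambda(w)\in\mathbf D^{\varepsilon}_{3,n}\cap\mathbf T_n$.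
   Context: $\mathbb N=\{1,2,\dots\}$; $A_n$ is an alphabet of $n$ letters; $\lambda$ is the empty word; $|u|_a$ is the number of occurrences of the letter $a$ in $u$. The period $\mathrm{per}(w)$ of a finite nonempty word $w$ is the least $p\ge1$ with $w(i)=w(i+p)$ for all $1\le i\le|w|-p$. $\mathbf T_n$ is the set of words over $A_n$ all of whose nonempty factors $v$ satisfy $|v|/\mathrm{per}(v)\le\frac n{n-1}$. For real $\varepsilon$, $\mathbf D^{\varepsilon}_{3,n}$ is the set of words $w\in A_n^*$ such that every factor $v$ of $w$ with $\mathrm{per}(v)\ge 3n-3$ satisfies $\frac{|v|+\varepsilon}{\mathrm{per}(v)}\le\frac n{n-1}$. $\mathrm{pref}_l(w)$, $\mathrm{suff}_l(w)$ are the prefix and suffix of $w$ of length $l\ge0$. $\mathbf l(\mathbf V)$ is the largest $m$ such that two different words of $\mathbf V$ have the same prefix of length $m$; $\mathbf r(\mathbf V)$ is the largest $m$ such that two different words of $\mathbf V$ have the same suffix of length $m$. Thus $f_\lambda$ replaces successive occurrences of each letter $a$ (read left to right) by $v_{a,1},v_{a,2},v_{a,3},v_{a,1},\dots$ cyclically. *)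

theory Defs
  imports Complex_Main "HOL-Library.Sublist" "HOL-Library.Disjoint_Sets"
begin

(* Letters are 0-indexed here. For the empty word, where the paper leaves the period
   undefined, this yields 1; all uses below are restricted to nonempty words. *)
definition per :: "'a list \<Rightarrow> nat" where
  "per w = (LEAST p. p \<ge> 1 \<and> (\<forall>i. i + p < length w \<longrightarrow> w ! i = w ! (i + p)))"

(* The alphabet A_n is an arbitrary set A; the theorem assumes card A = n. *)
definition T_words :: "'a set \<Rightarrow> nat \<Rightarrow> 'a list set" where
  "T_words A n =
     {w \<in> lists A. \<forall>v. sublist v w \<and> v \<noteq> [] \<longrightarrow>
        real (length v) / real (per v) \<le> real n / (real n - 1)}"

definition D3_words :: "real \<Rightarrow> 'a set \<Rightarrow> nat \<Rightarrow> 'a list set" where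
  "D3_words \<epsilon> A n =
     {w \<in> lists A. \<forall>v. sublist v w \<and> v \<noteq> [] \<and> 3 * n - 3 \<le> per v \<longrightarrow>
        (real (length v) + \<epsilon>) / real (per v) \<le> real n / (real n - 1)}"

(* take and the suffix below return the whole word when the requested length is too
   large, so common lengths are always bounded by the lengths of the words. *)
definition suff :: "nat \<Rightarrow> 'a list \<Rightarrow> 'a list" where
  "suff r w = drop (length w - r) w"

definition common_pref :: "nat \<Rightarrow> 'a list \<Rightarrow> 'a list \<Rightarrow> bool" where
  "common_pref l u v \<longleftrightarrow> l \<le> length u \<and> l \<le> length v \<and> take l u = take l v"

definition common_suff :: "nat \<Rightarrow> 'a list \<Rightarrow> 'a list \<Rightarrow> bool" where
  "common_suff r u v \<longleftrightarrow> r \<le> length u \<and> r \<le> length v \<and> suff r u = suff r v"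

definition max_pref :: "'a list set \<Rightarrow> nat" where
  "max_pref V = Max {m. \<exists>u\<in>V. \<exists>v\<in>V. u \<noteq> v \<and> common_pref m u v}"

definition max_suff :: "'a list set \<Rightarrow> nat" where
  "max_suff V = Max {m. \<exists>u\<in>V. \<exists>v\<in>V. u \<noteq> v \<and> common_suff m u v}"

(* ctx_subst v u w is f_u(w), where v a i (i = 1, 2, 3) is the word v_{a,i}. *)
fun ctx_subst :: "('a \<Rightarrow> nat \<Rightarrow> 'a list) \<Rightarrow> 'a list \<Rightarrow> 'a list \<Rightarrow> 'a list" where
  "ctx_subst v u [] = []"
| "ctx_subst v u (a # w) =
     v a ((count_list (u @ [a]) a - 1) mod 3 + 1) @ ctx_subst v (u @ [a]) w"

end

theory Submission
  imports Defs
begin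

text \<open>
A repetition in a word is a window of length \<open>t\<close> that is read again \<open>q\<close> places later. In terms of
\<open>q\<close> and \<open>t\<close> the two conditions say \<open>t * (n - 1) \<le> q\<close>, and \<open>(t + \<epsilon>) * (n - 1) \<le> q\<close> when
\<open>q \<ge> 3 * n - 3\<close> (\<open>mem_DT_iff\<close>). The image of \<open>w\<close> is a sequence of blocks of length \<open>L\<close>, and
a repetition in it falls into one of three cases.

If \<open>q < L\<close>, the repetition lies in two consecutive blocks, because a block has no period below
\<open>L\<close>; two consecutive blocks are different and covered by the hypothesis on pairs
(\<open>short_period\<close>).

If \<open>q \<ge> L\<close> is not a multiple of \<open>L\<close>, the window and its copy are cut into blocks at different
places. A block cannot occur across a block boundary (\<open>no_shifted_block\<close>), so the window is
short. A boundary in one of the two occurrences cuts the middle of a block in the other, and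
the hypothesis on pairs, applied on both sides of the cut, gives \<open>(t + \<epsilon>) * (n - 1) \<le> L\<close>
(\<open>boundary_inside_block\<close>, \<open>unaligned_period\<close>).

If \<open>q = Q * L\<close>, the copy respects the blocks. Equal blocks encode equal letters with equal
counters modulo 3; hence they are at least \<open>3 * (n - 1)\<close> blocks apart
(\<open>same_counter_gap\<close>), and \<open>m \<ge> 1\<close> consecutive equal pairs form a repetition in \<open>w\<close> whose period
\<open>Q\<close> is large enough for the bound with \<open>\<epsilon>\<close>. The ends of the window add at most \<open>\<epsilon> * (L - 1)\<close>
letters, and so \<open>(m + \<epsilon>) * (n - 1) \<le> Q\<close> scales to the claim. When no pair is equal, the smallness of
\<open>\<epsilon>\<close> suffices for \<open>Q \<ge> 2\<close>, and the hypothesis on three consecutive blocks is needed for \<open>Q = 1\<close>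
(\<open>aligned_period\<close>).
\<close>

section \<open>Repetitions and exponents\<close>

text \<open>The proof works with positions instead of factors: a repetition consists of a length-\<open>t\<close>
word read at \<open>i\<close> and again \<open>p\<close> places later, so that the factor of length \<open>p + t\<close> at \<open>i\<close>
has the period \<open>p\<close>. This period need not be the least one, which spares every later argument
a computation of \<^const>\<open>per\<close>.\<close>

definition rep :: "'a list \<Rightarrow> nat \<Rightarrow> nat \<Rightarrow> nat \<Rightarrow> bool" where
  "rep x i p t \<longleftrightarrow> 1 \<le> p \<and> i + p + t \<le> length x \<and> (\<forall>s<t. x ! (i + s) = x ! (i + p + s))"

text \<open>With a factor of length \<open>p + t\<close>, the bound \<open>n / (n - 1)\<close> on the exponent becomes
\<open>t * (n - 1) \<le> p\<close>, and likewise for the bound that carries \<open>\<epsilon>\<close>.\<close>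

definition low_rep :: "nat \<Rightarrow> real \<Rightarrow> 'a list \<Rightarrow> bool" where
  "low_rep n \<epsilon> x \<longleftrightarrow> (\<forall>i p t. rep x i p t \<longrightarrow>
     real t * (real n - 1) \<le> real p \<and>
     (3 * n - 3 \<le> p \<longrightarrow> (real t + \<epsilon>) * (real n - 1) \<le> real p))"

lemma per_period: "1 \<le> per w \<and> (\<forall>i. i + per w < length w \<longrightarrow> w ! i = w ! (i + per w))"
  unfolding per_def by (rule LeastI[of _ "Suc (length w)"]) simp

lemma per_le: "1 \<le> p \<Longrightarrow> (\<And>i. i + p < length w \<Longrightarrow> w ! i = w ! (i + p)) \<Longrightarrow> per w \<le> p"
  unfolding per_def by (rule Least_le) simp

lemma per_le_length: "w \<noteq> [] \<Longrightarrow> per w \<le> length w"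
  by (rule per_le) (simp_all add: Suc_le_eq)

lemma exponent_le_iff:
  assumes "n \<ge> (2::nat)" "p \<ge> (1::nat)" "m = p + t"
  shows "(real m + \<epsilon>) / real p \<le> real n / (real n - 1) \<longleftrightarrow> (real t + \<epsilon>) * (real n - 1) \<le> real p"
proof -
  have "(real m + \<epsilon>) / real p \<le> real n / (real n - 1)
      \<longleftrightarrow> (real p + real t + \<epsilon>) * (real n - 1) \<le> real n * real p"
    using assms by (simp add: divide_le_eq le_divide_eq field_simps)
  also have "\<dots> \<longleftrightarrow> (real t + \<epsilon>) * (real n - 1) \<le> real p"
    by (simp add: algebra_simps)
  finally show ?thesis .
qed

lemma rep_imp_factor:
  assumes "rep x i p t"
  obtains z where "sublist z x" "length z = p + t" "z \<noteq> []" "per z \<le> p"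
proof
  let ?z = "take (p + t) (drop i x)"
  have p: "1 \<le> p" and len: "i + p + t \<le> length x"
    and eq: "\<And>s. s < t \<Longrightarrow> x ! (i + s) = x ! (i + p + s)"
    using assms by (auto simp: rep_def)
  show "sublist ?z x"
    by (metis sublist_drop sublist_order.order_trans sublist_take)
  show lz: "length ?z = p + t" using len by simp
  then show "?z \<noteq> []" using p by fastforce
  show "per ?z \<le> p"
  proof (rule per_le[OF p])
    fix s assume "s + p < length ?z"
    with lz have "s < t" by simp
    with eq[of s] len show "?z ! s = ?z ! (s + p)" by (simp add: add_ac)
  qed
qed

lemma factor_imp_rep:
  assumes "sublist z x" "z \<noteq> []"
  obtains i t where "rep x i (per z) t" "length z = per z + t"
proof -
  obtain ps ss where x: "x = ps @ z @ ss" using assms(1) by (auto simp: sublist_def)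
  obtain t where t: "length z = per z + t" using per_le_length[OF assms(2)] le_Suc_ex by blast
  have "rep x (length ps) (per z) t"
    unfolding rep_def using per_period[of z] t
    by (auto simp: x nth_append add.commute)
  then show thesis using t that by blast
qed

text \<open>A non-minimal period makes the exponent smaller, so only one case needs an argument: the period
\<open>p\<close> is at least \<open>3 * n - 3\<close> while the least period falls below this threshold, where the bound
with \<open>\<epsilon>\<close> says nothing. There the exponent bound forces the whole factor to have at most
\<open>3 * n - 1\<close> letters, and the slack of one letter exceeds \<open>\<epsilon>\<close>.\<close>

lemma mem_DT_iff:
  assumes n: "n \<ge> 2" and e: "\<epsilon> < 1"
  shows "x \<in> D3_words \<epsilon> A n \<inter> T_words A n \<longleftrightarrow> x \<in> lists A \<and> low_rep n \<epsilon> x"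
proof
  assume x: "x \<in> D3_words \<epsilon> A n \<inter> T_words A n"
  have D: "(real (length z) + \<epsilon>) / real (per z) \<le> real n / (real n - 1)"
    if "sublist z x" "z \<noteq> []" "3 * n - 3 \<le> per z" for z
    using x that by (auto simp: D3_words_def)
  have T: "real (length z) / real (per z) \<le> real n / (real n - 1)"
    if "sublist z x" "z \<noteq> []" for z
    using x that by (auto simp: T_words_def)
  have "real t * (real n - 1) \<le> real p \<and>
     (3 * n - 3 \<le> p \<longrightarrow> (real t + \<epsilon>) * (real n - 1) \<le> real p)" if r: "rep x i p t" for i p t
  proof -
    obtain z where z: "sublist z x" "length z = p + t" "z \<noteq> []" "per z \<le> p"
      using rep_imp_factor[OF r] .
    obtain t' where t': "length z = per z + t'" using per_le_length[OF z(3)] le_Suc_ex by blast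
    have p1: "1 \<le> per z" using per_period by blast
    have n1: "real n - 1 \<ge> 1" using n by simp
    have a: "real t' * (real n - 1) \<le> real (per z)"
      using T[OF z(1,3)] exponent_le_iff[OF n p1 t', of 0] by simp
    have tt: "real t \<le> real t'" using z t' by simp
    have 1: "real t * (real n - 1) \<le> real p"
      using a tt n1 z(4) mult_right_mono[OF tt, of "real n - 1"] by linarith
    have 2: "(real t + \<epsilon>) * (real n - 1) \<le> real p" if p3: "3 * n - 3 \<le> p"
    proof (cases "3 * n - 3 \<le> per z")
      case True
      have b: "(real t' + \<epsilon>) * (real n - 1) \<le> real (per z)"
        using D[OF z(1,3) True] exponent_le_iff[OF n p1 t', of \<epsilon>] by simp
      have "(real t + \<epsilon>) * (real n - 1) \<le> (real t' + \<epsilon>) * (real n - 1)"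
        using tt n1 by (intro mult_right_mono) auto
      then show ?thesis using b z(4) by linarith
    next
      case False
      have "real t' * (real n - 1) < 3 * (real n - 1)"
        using a False n by (simp add: of_nat_diff)
      then have "real t' < 3" by (rule mult_right_less_imp_less) (use n1 in simp)
      then have "t' < 3" by simp
      moreover have "t + p = t' + per z" using z(2) t' by simp
      moreover have "per z < p" using False p3 by linarith
      ultimately have "t + 1 \<le> 2" by linarith
      then have "real t + \<epsilon> \<le> 3" using e by simp
      then have "(real t + \<epsilon>) * (real n - 1) \<le> 3 * (real n - 1)"
        using n1 by (intro mult_right_mono) auto
      also have "\<dots> \<le> real p"
      proof -
        have "3 * n \<le> p + 3" using p3 by linarith
        then have "real (3 * n) \<le> real (p + 3)" unfolding of_nat_le_iff .
        then show ?thesis by simp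
      qed
      finally show ?thesis .
    qed
    show ?thesis using 1 2 by blast
  qed
  then show "x \<in> lists A \<and> low_rep n \<epsilon> x"
    using x unfolding low_rep_def by (auto simp: T_words_def)
next
  assume x: "x \<in> lists A \<and> low_rep n \<epsilon> x"
  have "(real (length z)) / real (per z) \<le> real n / (real n - 1) \<and>
    (3 * n - 3 \<le> per z \<longrightarrow> (real (length z) + \<epsilon>) / real (per z) \<le> real n / (real n - 1))"
    if z: "sublist z x" "z \<noteq> []" for z
  proof -
    obtain i t where r: "rep x i (per z) t" and t: "length z = per z + t"
      using factor_imp_rep[OF z] .
    have p1: "1 \<le> per z" using per_period by blast
    show ?thesis using x r exponent_le_iff[OF n p1 t, of \<epsilon>] exponent_le_iff[OF n p1 t, of 0]
      by (auto simp: low_rep_def)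
  qed
  then show "x \<in> D3_words \<epsilon> A n \<inter> T_words A n"
    using x by (auto simp: D3_words_def T_words_def)
qed

section \<open>Overlaps of code words\<close>

text \<open>The code words as far as they matter for repetitions; \<open>lp\<close> and \<open>ls\<close> stand for
the lengths of the longest common prefix and suffix of two different code words. The bound \<open>\<epsilon> * (n - 1) \<le> 2\<close>
is a consequence of the bounds on \<open>x @ y\<close>: prolonging \<open>x\<close> by its common prefix with \<open>y\<close> is a
repetition of period \<open>L\<close>, and symmetrically for suffixes.\<close>

locale block_code =
  fixes n L :: nat and V :: "'a list set" and \<epsilon> :: real and lp ls :: nat
  assumes n: "n \<ge> 5" and L: "L \<ge> 6 * (n - 1)"
    and len: "x \<in> V \<Longrightarrow> length x = L"
    and no_period: "x \<in> V \<Longrightarrow> 1 \<le> p \<Longrightarrow> p < L \<Longrightarrow> \<exists>s. s + p < L \<and> x ! s \<noteq> x ! (s + p)"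
    and pair: "x \<in> V \<Longrightarrow> y \<in> V \<Longrightarrow> x \<noteq> y \<Longrightarrow> low_rep n \<epsilon> (x @ y)"
    and eps_0: "0 \<le> \<epsilon>" and eps_2: "\<epsilon> * (real n - 1) \<le> 2"
    and eps: "real lp + real ls = \<epsilon> * (real L - 1)"
    and lp: "x \<in> V \<Longrightarrow> y \<in> V \<Longrightarrow> x \<noteq> y \<Longrightarrow> t \<le> L \<Longrightarrow> (\<And>s. s < t \<Longrightarrow> x ! s = y ! s) \<Longrightarrow> t \<le> lp"
    and ls: "x \<in> V \<Longrightarrow> y \<in> V \<Longrightarrow> x \<noteq> y \<Longrightarrow> t \<le> L \<Longrightarrow>
       (\<And>s. s < t \<Longrightarrow> x ! (L - t + s) = y ! (L - t + s)) \<Longrightarrow> t \<le> ls"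
begin

lemma n1: "real n - 1 \<ge> 4"
  using n by simp

lemma L6: "6 * (real n - 1) \<le> real L"
proof -
  have "6 * n \<le> L + 6" using L n by linarith
  then have "real (6 * n) \<le> real (L + 6)" unfolding of_nat_le_iff .
  then show ?thesis by simp
qed

lemma eps_1: "\<epsilon> \<le> 1 / 2"
proof -
  have "\<epsilon> * 4 \<le> \<epsilon> * (real n - 1)" using eps_0 n1 by (intro mult_left_mono) auto
  then show ?thesis using eps_2 by simp
qed

text \<open>A common factor of \<open>x\<close> and \<open>y\<close> is a repetition in \<open>x @ y\<close>, whose period is the distance
between the two occurrences.\<close>

lemma pair_bound:
  assumes x: "x \<in> V" and y: "y \<in> V" and ne: "x \<noteq> y"
    and e: "e < L" "e + t \<le> L" "e' + t \<le> L"
    and eq: "\<And>s. s < t \<Longrightarrow> x ! (e + s) = y ! (e' + s)"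
  shows "real t * (real n - 1) \<le> real (L - e + e')"
    and "3 * n - 3 \<le> L - e + e' \<Longrightarrow> (real t + \<epsilon>) * (real n - 1) \<le> real (L - e + e')"
proof -
  have "rep (x @ y) e (L - e + e') t"
    unfolding rep_def using e eq len[OF x] len[OF y] by (auto simp: nth_append)
  then show "real t * (real n - 1) \<le> real (L - e + e')"
    and "3 * n - 3 \<le> L - e + e' \<Longrightarrow> (real t + \<epsilon>) * (real n - 1) \<le> real (L - e + e')"
    using pair[OF x y ne] unfolding low_rep_def by blast+
qed

text \<open>If the common factor starts in \<open>x\<close> no earlier than in \<open>y\<close>, the distance in \<open>x @ y\<close> is at most \<open>L\<close>.
For a distance below \<open>3 * n - 3\<close> the common factor has at most two letters, and
\<open>L \<ge> 6 * (n - 1)\<close> absorbs \<open>\<epsilon>\<close>.\<close>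

lemma pair_close:
  assumes x: "x \<in> V" and y: "y \<in> V" and ne: "x \<noteq> y"
    and e: "e' \<le> e" "e + t \<le> L" "1 \<le> t"
    and eq: "\<And>s. s < t \<Longrightarrow> x ! (e + s) = y ! (e' + s)"
  shows "(real t + \<epsilon>) * (real n - 1) \<le> real L"
proof (cases "3 * n - 3 \<le> L - e + e'")
  case True
  have "(real t + \<epsilon>) * (real n - 1) \<le> real (L - e + e')"
    using e eq by (intro pair_bound(2)[OF x y ne _ _ _ _ True]) auto
  also have "\<dots> \<le> real L" using e by simp
  finally show ?thesis .
next
  case False
  have "real t * (real n - 1) \<le> real (L - e + e')"
    using e eq by (intro pair_bound(1)[OF x y ne]) auto
  also have "\<dots> < 3 * (real n - 1)"
  proof -
    have "L - e + e' + 3 < 3 * n" using False n by linarith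
    then have "real (L - e + e' + 3) < real (3 * n)" unfolding of_nat_less_iff .
    then show ?thesis by simp
  qed
  finally have "real t < 3" by (rule mult_right_less_imp_less) (use n1 in simp)
  then have "(real t + \<epsilon>) * (real n - 1) \<le> 4 * (real n - 1)"
    using n1 eps_1 by (intro mult_right_mono) auto
  then show ?thesis using L6 n1 by linarith
qed

text \<open>The window of length \<open>a + b\<close> around the boundary between \<open>x\<close> and \<open>y\<close> reappears with that
boundary strictly inside \<open>u\<close>, at offset \<open>d\<close>. Its halves are repetitions in \<open>x @ u\<close> and
\<open>u @ y\<close> whose periods \<open>d\<close> and \<open>L - d\<close> add up to \<open>L\<close>. One of the two periods is at least
\<open>3 * n - 3\<close> because \<open>L \<ge> 6 * (n - 1)\<close>, so the sum of the two bounds contains the required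
\<open>\<epsilon>\<close>.\<close>

lemma boundary_inside_block:
  assumes V: "x \<in> V" "y \<in> V" "u \<in> V" and ne: "u \<noteq> x" "u \<noteq> y"
    and d: "0 < d" "d < L"
    and left: "\<And>s. s < a \<Longrightarrow> s < d \<Longrightarrow> x ! (L - 1 - s) = u ! (d - 1 - s)"
    and right: "\<And>s. s < b \<Longrightarrow> s < L - d \<Longrightarrow> y ! s = u ! (d + s)"
    and ab: "1 \<le> a"
  shows "(real (a + b) + \<epsilon>) * (real n - 1) \<le> real L"
proof -
  \<comment> \<open>Cutting the halves off at the ends of the middle block keeps them inside it. The bounds then show that nothing was cut off: a half as long as its own period would form a square.\<close>
  define a' where "a' = min a d"
  define b' where "b' = min b (L - d)"
  have l: "x ! (L - a' + s) = u ! (d - a' + s)" if "s < a'" for s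
  proof -
    have "L - 1 - (a' - 1 - s) = L - a' + s" "d - 1 - (a' - 1 - s) = d - a' + s"
      using that d by (auto simp: a'_def)
    moreover have "a' - 1 - s < a" "a' - 1 - s < d" using that by (auto simp: a'_def)
    ultimately show ?thesis using left[of "a' - 1 - s"] by metis
  qed
  have r: "u ! (d + s) = y ! (0 + s)" if "s < b'" for s
    using right[of s] that by (simp add: b'_def)
  have A: "L - (L - a') + (d - a') = d" using d by (auto simp: a'_def)
  have B: "L - d + 0 = L - d" by simp
  have ha: "L - a' < L" "L - a' + a' \<le> L" "d - a' + a' \<le> L" using d ab by (auto simp: a'_def)
  have hb: "d + b' \<le> L" "0 + b' \<le> L" using d by (auto simp: b'_def)
  note P = pair_bound[OF V(1) V(3) ne(1)[symmetric] ha l, unfolded A]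
  note Q = pair_bound[OF V(3) V(2) ne(2) d(2) hb r, unfolded B]
  have small: "4 * real t \<le> real t * (real n - 1)" for t
    using mult_left_mono[OF n1, of "real t"] by (simp add: mult.commute)
  have "4 * real a' \<le> real d" using small[of a'] P(1) by linarith
  then have a: "a' = a" using d unfolding a'_def min_def by (auto split: if_splits)
  have "4 * real b' \<le> real (L - d)" using small[of b'] Q(1) by linarith
  then have b: "b' = b" using d unfolding b'_def min_def by (auto split: if_splits)
  have dd: "real d + real (L - d) = real L" using d by simp
  have "3 * n - 3 \<le> d \<or> 3 * n - 3 \<le> L - d" using L by linarith
  then have "(real a' + real b' + \<epsilon>) * (real n - 1) \<le> real d + real (L - d)"
    using P Q by (auto simp: algebra_simps)
  then show ?thesis using dd by (simp add: a b)
qed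

text \<open>A code word lying across the boundary of \<open>u @ u'\<close> would make a square in \<open>u @ x\<close> if
\<open>x \<noteq> u\<close>, and a square in \<open>x @ u'\<close> if \<open>x = u\<close>.\<close>

lemma no_shifted_block:
  assumes V: "x \<in> V" "u \<in> V" "u' \<in> V" and ne: "u \<noteq> u'"
    and d: "0 < d" "d < L"
    and left: "\<And>s. s < L - d \<Longrightarrow> x ! s = u ! (d + s)"
    and right: "\<And>s. s < d \<Longrightarrow> x ! (L - d + s) = u' ! s"
  shows False
proof (cases "x = u")
  case False
  have "real (L - d) * (real n - 1) \<le> real (L - d + 0)"
    using False d left by (intro pair_bound(1)[OF V(2) V(1)]) auto
  moreover have "real (L - d) * 4 \<le> real (L - d) * (real n - 1)"
    by (rule mult_left_mono[OF n1 of_nat_0_le_iff])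
  ultimately show False using d by linarith
next
  case True
  have "real d * (real n - 1) \<le> real (L - (L - d) + 0)"
    using True ne d right by (intro pair_bound(1)[OF V(1) V(3)]) auto
  moreover have "real d * 4 \<le> real d * (real n - 1)"
    by (rule mult_left_mono[OF n1 of_nat_0_le_iff])
  ultimately show False using d by linarith
qed

end

section \<open>Repetitions in sequences of code words\<close>

text \<open>A word \<open>W\<close> made of code blocks \<open>B 0\<close>, ..., \<open>B (N - 1)\<close>. The assumptions on \<open>B\<close> are what the
encoded word contributes: equal blocks are far apart, runs of equal blocks are repetitions
of letters, and three consecutive blocks satisfy the hypothesis on common prefixes and suffixes.\<close>

locale coded_word = block_code n L V \<epsilon> lp ls
  for n L :: nat and V :: "'a list set" and \<epsilon> :: real and lp ls :: nat +
  fixes N :: nat and B :: "nat \<Rightarrow> 'a list" and W :: "'a list"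
  assumes B_V: "j < N \<Longrightarrow> B j \<in> V"
    and W_len: "length W = N * L"
    and W_nth: "j < N \<Longrightarrow> e < L \<Longrightarrow> W ! (j * L + e) = B j ! e"
    and B_far: "j < k \<Longrightarrow> k < N \<Longrightarrow> B j = B k \<Longrightarrow> j + 3 * (n - 1) \<le> k"
    and B_low: "1 \<le> k \<Longrightarrow> 1 \<le> m \<Longrightarrow> j + k + m \<le> N \<Longrightarrow> (\<And>s. s < m \<Longrightarrow> B (j + s) = B (j + k + s)) \<Longrightarrow>
       (real m + \<epsilon>) * (real n - 1) \<le> real k"
    and B_triple: "j + 2 < N \<Longrightarrow> a \<le> L \<Longrightarrow> b \<le> L \<Longrightarrow>
       (\<And>s. s < a \<Longrightarrow> B j ! (L - a + s) = B (j + 1) ! (L - a + s)) \<Longrightarrow>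
       (\<And>s. s < b \<Longrightarrow> B (j + 1) ! s = B (j + 2) ! s) \<Longrightarrow>
       (real (a + b) + \<epsilon>) * (real n - 1) \<le> real L"
    and other: "x \<in> V \<Longrightarrow> \<exists>y\<in>V. y \<noteq> x"
begin

lemma L_pos: "24 \<le> L"
  using L n by linarith

lemma B_nth: "j < N \<Longrightarrow> e < L \<Longrightarrow> k = j * L + e \<Longrightarrow> B j ! e = W ! k"
  by (simp add: W_nth)

lemma B_len: "j < N \<Longrightarrow> length (B j) = L"
  by (simp add: B_V len)

lemma index_less: "a * L + x \<le> N * L \<Longrightarrow> 0 < x \<Longrightarrow> a < N"
  by (metis add_lessD1 less_add_same_cancel1 linorder_not_less mult_le_mono1 order_less_le_trans)

lemma position:
  obtains I e where "i = I * L + e" "e < L"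
proof
  show "i = (i div L) * L + i mod L" by simp
  show "i mod L < L" using L_pos by simp
qed

text \<open>A factor that is not contained in two consecutive blocks contains a whole block in its interior, and
no block has a period smaller than \<open>L\<close>.\<close>

lemma short_period:
  assumes r: "rep W i q t" and q: "q < L"
  shows "real t * (real n - 1) \<le> real q \<and>
     (3 * n - 3 \<le> q \<longrightarrow> (real t + \<epsilon>) * (real n - 1) \<le> real q)"
proof -
  have q1: "1 \<le> q" and bound: "i + q + t \<le> N * L"
    and eq: "\<And>s. s < t \<Longrightarrow> W ! (i + s) = W ! (i + q + s)"
    using r by (auto simp: rep_def W_len)
  obtain I e where i: "i = I * L + e" "e < L" by (rule position)
  have IN: "I < N" using bound i q1 index_less[of I "e + q + t"] by (simp add: add_ac)
  have "\<exists>x y. x \<in> V \<and> y \<in> V \<and> x \<noteq> y \<and> rep (x @ y) e q t"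
  proof (cases "I + 1 < N")
    case True
    have nth: "(B I @ B (I + 1)) ! k = W ! (I * L + k)" if "k < 2 * L" for k
      using that True B_len[OF IN] W_nth[OF IN, of k] W_nth[OF True, of "k - L"]
      by (auto simp: nth_append add.commute add.left_commute)
    have "e + q + t \<le> 2 * L"
    proof (rule ccontr)
      assume long: "\<not> e + q + t \<le> 2 * L"
      obtain s where s: "s + q < L" "B (I + 1) ! s \<noteq> B (I + 1) ! (s + q)"
        using no_period[OF B_V[OF True] q1 q] by blast
      have st: "L - e + s < t" using long s i by linarith
      have "B (I + 1) ! s = W ! (i + (L - e + s))"
        using True s i by (intro B_nth) auto
      also have "\<dots> = W ! (i + q + (L - e + s))" by (rule eq[OF st])
      also have "\<dots> = B (I + 1) ! (s + q)"
        using True s i by (intro B_nth[symmetric]) auto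
      finally show False using s by blast
    qed
    moreover have "(B I @ B (I + 1)) ! (e + s) = (B I @ B (I + 1)) ! (e + q + s)"
      if "s < t" for s
      using eq[OF that] nth[of "e + s"] nth[of "e + q + s"] that \<open>e + q + t \<le> 2 * L\<close> i
      by (simp add: add_ac)
    ultimately have "rep (B I @ B (I + 1)) e q t"
      unfolding rep_def using q1 B_len[OF IN] B_len[OF True] by auto
    moreover have "B I \<noteq> B (I + 1)" using B_far[of I "I + 1"] True n by auto
    ultimately show ?thesis using B_V IN True by blast
  next
    case False
    then have N: "N = I + 1" using IN by linarith
    obtain y where y: "y \<in> V" "y \<noteq> B I" using other B_V[OF IN] by blast
    have short: "e + q + t \<le> L" using bound i N by simp
    have nth: "(B I @ y) ! k = W ! (I * L + k)" if "k < L" for k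
      using that B_len[OF IN] W_nth[OF IN, of k] by (auto simp: nth_append)
    have "(B I @ y) ! (e + s) = (B I @ y) ! (e + q + s)" if "s < t" for s
      using eq[OF that] nth[of "e + s"] nth[of "e + q + s"] that short i
      by (simp add: add_ac)
    then have "rep (B I @ y) e q t"
      unfolding rep_def using q1 B_len[OF IN] len[OF y(1)] short by auto
    then show ?thesis using y B_V[OF IN] by metis
  qed
  then show ?thesis using pair unfolding low_rep_def by blast
qed

text \<open>Shifting by \<open>q\<close> moves every block boundary strictly inside a block. If the window or its copy has a
boundary in its interior, \<open>boundary_inside_block\<close> applies, and otherwise \<open>pair_close\<close>; both bound
\<open>(t + \<epsilon>) * (n - 1)\<close> by \<open>L \<le> q\<close>. They need different blocks. A window containing a whole
block contradicts \<open>no_shifted_block\<close>, so \<open>t < 2 * L\<close>; a violation then has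
\<open>q < 2 * (n - 1) * L\<close>, and blocks at such a distance differ.\<close>

lemma unaligned_period:
  assumes r: "rep W i q t" and q: "L \<le> q" "\<not> L dvd q"
  shows "(real t + \<epsilon>) * (real n - 1) \<le> real q"
proof (rule ccontr)
  assume neg: "\<not> ?thesis"
  have bound: "i + q + t \<le> N * L"
    and eq: "\<And>s. s < t \<Longrightarrow> W ! (i + s) = W ! (i + q + s)"
    using r by (auto simp: rep_def W_len)
  obtain Q d where Q: "q = Q * L + d" "d < L" by (rule position)
  have d: "0 < d" using q Q by (cases d) auto
  have Q1: "1 \<le> Q" using q Q by (cases Q) auto
  obtain I e where i: "i = I * L + e" "e < L" by (rule position)
  have eq': "W ! a = W ! b" if "a = i + s" "b = i + q + s" "s < t" for a b s
    using eq that by simp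
  \<comment> \<open>A window of two block lengths contains a whole block, wherever it starts.\<close>
  have t2: "t < 2 * L"
  proof (rule ccontr)
    assume t: "\<not> t < 2 * L"
    have N: "I + Q + 2 < N"
      using bound i Q d t by (intro index_less[of _ "e + d + t - 2 * L"]) (auto simp: algebra_simps)
    show False
    proof (rule no_shifted_block[of "B (I + 1)" "B (I + 1 + Q)" "B (I + 2 + Q)" d])
      show "B (I + 1 + Q) \<noteq> B (I + 2 + Q)" using B_far[of "I + 1 + Q" "I + 2 + Q"] N n by auto
      fix s assume s: "s < L - d"
      have "B (I + 1) ! s = W ! ((I + 1) * L + s)" using N s by (intro B_nth) auto
      also have "\<dots> = W ! ((I + 1 + Q) * L + (d + s))"
        using s t i by (intro eq'[of _ "L - e + s"]) (auto simp: Q algebra_simps)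
      also have "\<dots> = B (I + 1 + Q) ! (d + s)" using N s by (intro B_nth[symmetric]) auto
      finally show "B (I + 1) ! s = B (I + 1 + Q) ! (d + s)" .
    next
      fix s assume s: "s < d"
      have "B (I + 1) ! (L - d + s) = W ! ((I + 1) * L + (L - d + s))"
        using N s Q by (intro B_nth) auto
      also have "\<dots> = W ! ((I + 2 + Q) * L + s)"
        using s t i Q by (intro eq'[of _ "L - e + (L - d + s)"]) (auto simp: algebra_simps)
      also have "\<dots> = B (I + 2 + Q) ! s" using N s Q by (intro B_nth[symmetric]) auto
      finally show "B (I + 1) ! (L - d + s) = B (I + 2 + Q) ! s" .
    qed (use N Q d B_V in auto)
  qed
  have "real (Q * L) < real (2 * (n - 1) * L)"
  proof -
    have "real (Q * L) \<le> real q" using Q by simp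
    also have "\<dots> < (real t + \<epsilon>) * (real n - 1)" using neg by simp
    also have "\<dots> \<le> (2 * real L) * (real n - 1)"
      using t2 eps_1 n1 by (intro mult_right_mono) auto
    also have "\<dots> = real (2 * (n - 1) * L)" using n by (simp add: of_nat_diff)
    finally show ?thesis .
  qed
  then have "Q < 2 * (n - 1)" by (metis mult_less_cancel2 of_nat_less_iff)
  then have distinct: "B j \<noteq> B k" if "j < k" "k \<le> j + Q + 1" "k < N" for j k
    using B_far[OF that(1,3)] that(2) n by linarith
  have close: "\<not> (real t + \<epsilon>) * (real n - 1) \<le> real L" using neg q by linarith
  have t1: "1 \<le> t"
  proof (rule ccontr)
    assume "\<not> 1 \<le> t"
    then show False using close eps_2 L_pos by (simp add: not_le)
  qed
  obtain K e' where K: "i + q = K * L + e'" "e' < L" by (rule position)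
  have KQ: "K = I + Q \<or> K = I + Q + 1"
  proof -
    have "K * L < (I + Q + 2) * L" "(I + Q) * L < (K + 1) * L"
      using K i Q by (auto simp: algebra_simps)
    then have "K < I + Q + 2" "I + Q < K + 1" unfolding mult_less_cancel2 by blast+
    then show ?thesis by linarith
  qed
  \<comment> \<open>A boundary inside the left window, a boundary inside the right window, or none in either.\<close>
  consider "L < e + t" | "L < e' + t" | "e + t \<le> L" "e' + t \<le> L" by linarith
  then show False
  proof cases
    case 1
    have N: "I + 1 + Q < N"
      using bound i Q d 1 by (intro index_less[of _ "e + d + t - L"]) (auto simp: algebra_simps)
    have "(real ((L - e) + (t - (L - e))) + \<epsilon>) * (real n - 1) \<le> real L"
    proof (rule boundary_inside_block[of "B I" "B (I + 1)" "B (I + 1 + Q)" d])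
      fix s assume s: "s < L - e" "s < d"
      have "B I ! (L - 1 - s) = W ! (I * L + (L - 1 - s))" using N s by (intro B_nth) auto
      also have "\<dots> = W ! ((I + 1 + Q) * L + (d - 1 - s))"
        using s 1 i Q by (intro eq'[of _ "L - 1 - s - e"]) (auto simp: algebra_simps)
      also have "\<dots> = B (I + 1 + Q) ! (d - 1 - s)" using N s Q by (intro B_nth[symmetric]) auto
      finally show "B I ! (L - 1 - s) = B (I + 1 + Q) ! (d - 1 - s)" .
    next
      fix s assume s: "s < t - (L - e)" "s < L - d"
      have "B (I + 1) ! s = W ! ((I + 1) * L + s)" using N s by (intro B_nth) auto
      also have "\<dots> = W ! ((I + 1 + Q) * L + (d + s))"
        using s 1 i Q by (intro eq'[of _ "L - e + s"]) (auto simp: algebra_simps)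
      also have "\<dots> = B (I + 1 + Q) ! (d + s)" using N s Q by (intro B_nth[symmetric]) auto
      finally show "B (I + 1) ! s = B (I + 1 + Q) ! (d + s)" .
    qed (use N Q Q1 d i B_V distinct[of I "I + 1 + Q"] distinct[of "I + 1" "I + 1 + Q"] in auto)
    then show False using close 1 by simp
  next
    case 2
    have N: "K + 1 < N"
      using bound K 2 by (intro index_less[of _ "e' + t - L"]) (auto simp: algebra_simps)
    obtain J where J: "K = J + Q" using KQ by (metis add.assoc add.commute)
    have "(real ((L - e') + (t - (L - e'))) + \<epsilon>) * (real n - 1) \<le> real L"
    proof (rule boundary_inside_block[of "B K" "B (K + 1)" "B J" "L - d"])
      fix s assume s: "s < L - e'" "s < L - d"
      have "B K ! (L - 1 - s) = W ! (K * L + (L - 1 - s))" using N s by (intro B_nth) auto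
      also have "\<dots> = W ! (J * L + (L - d - 1 - s))"
        using s 2 K Q by (intro eq'[of _ "L - 1 - s - e'", symmetric]) (auto simp: J algebra_simps)
      also have "\<dots> = B J ! (L - d - 1 - s)" using N s Q J by (intro B_nth[symmetric]) auto
      finally show "B K ! (L - 1 - s) = B J ! (L - d - 1 - s)" .
    next
      fix s assume s: "s < t - (L - e')" "s < L - (L - d)"
      have "B (K + 1) ! s = W ! ((K + 1) * L + s)" using N s by (intro B_nth) auto
      also have "\<dots> = W ! (J * L + (L - d + s))"
        using s 2 K Q by (intro eq'[of _ "L - e' + s", symmetric]) (auto simp: J algebra_simps)
      also have "\<dots> = B J ! (L - d + s)" using N s Q J by (intro B_nth[symmetric]) auto
      finally show "B (K + 1) ! s = B J ! (L - d + s)" .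
    qed (use N Q Q1 d K J B_V distinct[of J K] distinct[of J "K + 1"] in auto)
    then show False using close 2 by simp
  next
    case 3
    have N: "K < N" using bound K t1 by (intro index_less[of _ "e' + t"]) auto
    have IK: "I < K" using KQ Q1 by linarith
    have ne: "B I \<noteq> B K" using distinct[OF IK _ N] KQ by auto
    have IN: "I < N" using IK N by simp
    have m: "B I ! (e + s) = B K ! (e' + s)" if "s < t" for s
    proof -
      have "B I ! (e + s) = W ! (i + s)" using that 3 IN i by (intro B_nth) auto
      also have "\<dots> = W ! (i + q + s)" by (rule eq[OF that])
      also have "\<dots> = B K ! (e' + s)" using that 3 N K by (intro B_nth[symmetric]) auto
      finally show ?thesis .
    qed
    show False
    proof (cases "e' \<le> e")
      case True
      show False
        using close pair_close[OF B_V[OF IN] B_V[OF N] ne True 3(1) t1 m] by blast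
    next
      case False
      then show False
        using close pair_close[OF B_V[OF N] B_V[OF IN] ne[symmetric] _ 3(2) t1 m[symmetric]] by simp
    qed
  qed
qed

text \<open>Blocks are compared with blocks at distance \<open>Q\<close>. If \<open>m\<close> of the pairs that the window meets
are equal, then \<open>t \<le> m * L + lp + ls = m * L + \<epsilon> * (L - 1)\<close>; this equation is the reason for
the value of \<open>\<epsilon>\<close>. For \<open>m \<ge> 1\<close> the bound \<open>(m + \<epsilon>) * (n - 1) \<le> Q\<close> for letters, multiplied by
\<open>L\<close>, is the claim. For \<open>m = 0\<close> the window is shorter than \<open>\<epsilon> * L\<close>, which suffices if
\<open>Q \<ge> 2\<close>; adjacent blocks are the case of the hypothesis on three consecutive blocks. A window
within a single unequal pair is neither prefix nor suffix, but a common factor of two code words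
at the same offset, hence a repetition of period \<open>L\<close>.\<close>

lemma aligned_period:
  assumes r: "rep W i (Q * L) t"
  shows "(real t + \<epsilon>) * (real n - 1) \<le> real (Q * L)"
proof -
  have bound: "i + Q * L + t \<le> N * L"
    and eq: "\<And>s. s < t \<Longrightarrow> W ! (i + s) = W ! (i + Q * L + s)"
    and Q1: "1 \<le> Q"
    using r by (auto simp: rep_def W_len Suc_le_eq)
  have LQ: "L \<le> Q * L" using Q1 by simp
  have scale: "(real m * real L + \<epsilon> * real L) * (real n - 1) \<le> real (Q * L)"
    if "(real m + \<epsilon>) * (real n - 1) \<le> real Q" for m
    using mult_right_mono[OF that, of "real L"] by (simp add: algebra_simps)
  have eL: "\<epsilon> \<le> \<epsilon> * real L" using eps_0 L_pos mult_left_mono[of 1 "real L" \<epsilon>] by simp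
  obtain I e where i: "i = I * L + e" "e < L" by (rule position)
  have block: "B j ! x = B (j + Q) ! x" if "j * L + x = i + s" "s < t" "x < L" for j x s
  proof -
    have "(j + Q) * L + x + 1 \<le> N * L" using bound that by (simp add: algebra_simps)
    then have "j + Q < N" by (intro index_less[of _ "x + 1"]) auto
    have "B j ! x = W ! (i + s)" using \<open>j + Q < N\<close> that by (intro B_nth) auto
    also have "\<dots> = W ! (i + Q * L + s)" by (rule eq[OF that(2)])
    also have "\<dots> = B (j + Q) ! x"
      using \<open>j + Q < N\<close> that by (intro B_nth[symmetric]) (auto simp: algebra_simps)
    finally show ?thesis .
  qed
  consider "t = 0" | "1 \<le> t" "e + t \<le> L" | "L < e + t" by linarith
  then show ?thesis
  proof cases
    case 1
    have "real L \<le> real (Q * L)" using LQ of_nat_le_iff by blast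
    moreover have "(real t + \<epsilon>) * (real n - 1) \<le> 2" using 1 eps_2 by simp
    ultimately show ?thesis using L_pos by linarith
  next
    case 2
    have N: "I + Q < N"
      using bound i 2 by (intro index_less[of _ "e + t"]) (auto simp: algebra_simps)
    show ?thesis
    proof (cases "B I = B (I + Q)")
      case False
      have "(real t + \<epsilon>) * (real n - 1) \<le> real L"
      proof (rule pair_close[OF B_V B_V False order_refl 2(2,1)])
        fix s assume "s < t"
        then show "B I ! (e + s) = B (I + Q) ! (e + s)"
          using 2 i by (intro block[of _ _ s]) auto
      qed (use N in auto)
      also have "\<dots> \<le> real (Q * L)" using LQ of_nat_le_iff by blast
      finally show ?thesis .
    next
      case True
      have "(real 1 + \<epsilon>) * (real n - 1) \<le> real Q"
        using True N Q1 by (intro B_low[of _ _ I]) auto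
      from scale[OF this] have "(real L + \<epsilon> * real L) * (real n - 1) \<le> real (Q * L)" by simp
      moreover have "(real t + \<epsilon>) * (real n - 1) \<le> (real L + \<epsilon> * real L) * (real n - 1)"
        using 2 eL n1 by (intro mult_right_mono) auto
      ultimately show ?thesis by linarith
    qed
  next
    case 3
    \<comment> \<open>The window splits into a suffix of a block, M whole blocks and a nonempty prefix of length g of the last block F.\<close>
    obtain M g' where M: "t - (L - e) - 1 = M * L + g'" "g' < L" by (rule position)
    define g where "g = Suc g'"
    have g: "1 \<le> g" "g \<le> L" and t: "t = (L - e) + M * L + g"
      using M 3 i by (auto simp: g_def)
    define F where "F = I + 1 + M"
    have N: "F + Q < N"
      using bound i g by (intro index_less[of _ g]) (auto simp: F_def t algebra_simps)
    have first: "B I ! x = B (I + Q) ! x" if "e \<le> x" "x < L" for x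
      using that i t by (intro block[of _ _ "x - e"]) auto
    have last: "B F ! x = B (F + Q) ! x" if "x < g" for x
      using that i t g by (intro block[of _ _ "L - e + M * L + x"]) (auto simp: F_def algebra_simps)
    have middle: "B (I + 1 + s) = B (I + 1 + s + Q)" if s: "s < M" for s
    proof (rule nth_equalityI)
      have "s * L + L \<le> M * L" using s by (metis Suc_leI mult_Suc mult_le_mono1 add.commute)
      then show "B (I + 1 + s) ! x = B (I + 1 + s + Q) ! x" if "x < length (B (I + 1 + s))" for x
        using that i t g s N
        by (intro block[of _ _ "L - e + s * L + x"]) (auto simp: B_len F_def algebra_simps)
    qed (use s N in \<open>auto simp: B_len F_def\<close>)
    \<comment> \<open>An end block that equals its partner counts as a whole block; otherwise ls or lp bounds the part of it in the window.\<close>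
    define lo where "lo = (if B I = B (I + Q) then 0 else 1 :: nat)"
    define hi where "hi = (if B F = B (F + Q) then 1 else 0 :: nat)"
    define m where "m = M + hi + 1 - lo"
    have "L - e \<le> ls + (1 - lo) * L"
    proof (cases "B I = B (I + Q)")
      case False
      have "L - e \<le> ls"
        by (rule ls[OF B_V B_V False]) (use N i first in \<open>auto simp: F_def\<close>)
      then show ?thesis by simp
    qed (simp add: lo_def)
    moreover have "g \<le> lp + hi * L"
    proof (cases "B F = B (F + Q)")
      case False
      have "g \<le> lp"
        by (rule lp[OF B_V B_V False]) (use N g last in auto)
      then show ?thesis by simp
    qed (use g in \<open>simp add: hi_def\<close>)
    moreover have "m * L = M * L + hi * L + (1 - lo) * L"
      by (auto simp: m_def lo_def algebra_simps)
    ultimately have "t \<le> m * L + lp + ls" using t by linarith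
    then have "real t \<le> real (m * L + lp + ls)" unfolding of_nat_le_iff .
    then have tm: "real t + \<epsilon> \<le> real m * real L + \<epsilon> * real L"
      using eps by (simp add: algebra_simps)
    show ?thesis
    proof (cases "1 \<le> m")
      case True
      have "(real m + \<epsilon>) * (real n - 1) \<le> real Q"
      proof (rule B_low[OF Q1 True, of "I + lo"])
        show "I + lo + Q + m \<le> N" using N by (auto simp: m_def lo_def hi_def F_def)
        fix s assume s: "s < m"
        consider "lo + s = 0" | "1 \<le> lo + s" "lo + s \<le> M" | "lo + s = M + 1" "hi = 1"
          using s by (fastforce simp: m_def lo_def hi_def split: if_splits)
        then show "B (I + lo + s) = B (I + lo + Q + s)"
        proof cases
          case 1 then show ?thesis by (simp add: lo_def split: if_splits)
        next
          case 2
          then obtain s' where "lo + s = Suc s'" by (cases "lo + s") auto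
          then have idx: "I + lo + s = I + 1 + s'" "I + lo + Q + s = I + 1 + s' + Q" "s' < M"
            using 2 by simp_all
          show ?thesis unfolding idx(1,2) by (rule middle[OF idx(3)])
        next
          case 3
          then have idx: "I + lo + s = F" "I + lo + Q + s = F + Q" by (simp_all add: F_def)
          show ?thesis unfolding idx using 3(2) by (simp add: hi_def split: if_splits)
        qed
      qed
      from scale[OF this] mult_right_mono[OF tm, of "real n - 1"] n1 show ?thesis by linarith
    next
      case False
      then have m0: "m = 0" "M = 0" by (auto simp: m_def lo_def split: if_splits)
      show ?thesis
      proof (cases "Q = 1")
        case True
        have "(real ((L - e) + g) + \<epsilon>) * (real n - 1) \<le> real L"
        proof (rule B_triple[of I])
          show "I + 2 < N" using N True m0 by (simp add: F_def)
        qed (use g first last m0 True i in \<open>auto simp: F_def\<close>)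
        then show ?thesis using True m0 t by simp
      next
        case False
        have "(real t + \<epsilon>) * (real n - 1) \<le> (\<epsilon> * real L) * (real n - 1)"
          using tm m0 n1 by (intro mult_right_mono) auto
        also have "\<dots> = (\<epsilon> * (real n - 1)) * real L" by simp
        also have "\<dots> \<le> 2 * real L" using eps_2 by (intro mult_right_mono) auto
        also have "\<dots> \<le> real Q * real L" using False Q1 by (intro mult_right_mono) auto
        finally show ?thesis by simp
      qed
    qed
  qed
qed

lemma low_rep_W: "low_rep n \<epsilon> W"
  unfolding low_rep_def
proof (intro allI impI)
  fix i q t assume r: "rep W i q t"
  show "real t * (real n - 1) \<le> real q \<and>
     (3 * n - 3 \<le> q \<longrightarrow> (real t + \<epsilon>) * (real n - 1) \<le> real q)"
  proof (cases "q < L")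
    case True
    then show ?thesis using short_period r by blast
  next
    case False
    have "(real t + \<epsilon>) * (real n - 1) \<le> real q"
    proof (cases "L dvd q")
      case True
      then show ?thesis using aligned_period r by (metis dvd_div_mult_self)
    next
      case nd: False
      then show ?thesis using unaligned_period r False by simp
    qed
    moreover have "real t * (real n - 1) \<le> (real t + \<epsilon>) * (real n - 1)"
      using eps_0 n1 by (intro mult_right_mono) auto
    ultimately show ?thesis by linarith
  qed
qed

end

section \<open>The encoded word\<close>

lemma ctx_subst_concat:
  "ctx_subst v u w =
     concat (map (\<lambda>j. v (w ! j) ((count_list (u @ take (j + 1) w) (w ! j) - 1) mod 3 + 1)) [0..<length w])"
proof (induction v u w rule: ctx_subst.induct)
  case (2 v u a w)
  have "[0..<length (a # w)] = 0 # map Suc [0..<length w]"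
    by (simp add: upt_conv_Cons map_Suc_upt del: upt_Suc)
  with 2 show ?case by (simp add: comp_def del: upt_Suc cong: if_cong)
qed simp

lemma nth_concat_uniform:
  assumes "\<And>x. x \<in> set xs \<Longrightarrow> length x = L" "j < length xs" "e < L"
  shows "concat xs ! (j * L + e) = xs ! j ! e"
  using assms
proof (induction xs arbitrary: j)
  case (Cons x xs)
  then show ?case by (cases j) (auto simp: nth_append)
qed simp

text \<open>Dividing by \<open>g\<close> puts the elements into different classes.\<close>

lemma spaced_card:
  fixes S :: "nat set"
  assumes "S \<subseteq> {j..k}" "g \<ge> 1" "\<And>p p'. p \<in> S \<Longrightarrow> p' \<in> S \<Longrightarrow> p < p' \<Longrightarrow> p + g \<le> p'"
  shows "card S \<le> (k - j) div g + 1"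
proof -
  have "card S \<le> card {..(k - j) div g}"
  proof (rule card_inj_on_le)
    show "(\<lambda>p. (p - j) div g) ` S \<subseteq> {..(k - j) div g}"
      using assms(1) by (auto intro!: div_le_mono diff_le_mono)
    have neq: "(p - j) div g \<noteq> (p' - j) div g" if "p \<in> S" "p' \<in> S" "p < p'" for p p'
    proof -
      have "(p - j) + g \<le> p' - j" using assms that by fastforce
      then have "((p - j) + g) div g \<le> (p' - j) div g" by (rule div_le_mono)
      then show ?thesis using assms(2) by simp
    qed
    show "inj_on (\<lambda>p. (p - j) div g) S"
      by (rule inj_onI) (metis neq linorder_neqE_nat)
  qed simp
  then show ?thesis by simp
qed

lemma count_list_take:
  assumes "j < length w"
  shows "count_list (take (j + 1) w) a = card {p. p \<le> j \<and> w ! p = a}"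
proof -
  have "count_list (take (j + 1) w) a = card {p. p < length (take (j + 1) w) \<and> a = take (j + 1) w ! p}"
    by (simp add: count_list_eq_length_filter length_filter_conv_card)
  also have "{p. p < length (take (j + 1) w) \<and> a = take (j + 1) w ! p} = {p. p \<le> j \<and> w ! p = a}"
    using assms by (auto simp: less_Suc_eq_le)
  finally show ?thesis .
qed

lemma letter_gap:
  assumes "low_rep n \<epsilon> w" "1 \<le> n" "p < q" "q < length w" "w ! p = w ! q"
  shows "p + (n - 1) \<le> q"
proof -
  have "rep w p (q - p) 1" unfolding rep_def using assms by auto
  then have "real 1 * (real n - 1) \<le> real (q - p)" using assms(1) unfolding low_rep_def by blast
  then have "real n \<le> real (q - p + 1)" by simp
  then have "n \<le> q - p + 1" unfolding of_nat_le_iff .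
  then show ?thesis using assms(3) by linarith
qed

text \<open>Equal counters modulo 3 mean that a positive multiple of three occurrences of \<open>a\<close> lies in
\<open>{j<..k}\<close>, so the distance consists of at least three gaps between equal letters.\<close>

lemma same_counter_gap:
  assumes w: "low_rep n \<epsilon> w" and n: "2 \<le> n" and jk: "j < k" "k < length w"
    and a: "w ! j = a" "w ! k = a"
    and c: "(count_list (take (j + 1) w) a - 1) mod 3 = (count_list (take (k + 1) w) a - 1) mod 3"
  shows "j + 3 * (n - 1) \<le> k"
proof -
  define S where "S = {p. j < p \<and> p \<le> k \<and> w ! p = a}"
  have finS: "finite S" by (rule finite_subset[of _ "{..k}"]) (auto simp: S_def)
  have "card {p. p \<le> k \<and> w ! p = a} = card ({p. p \<le> j \<and> w ! p = a} \<union> S)"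
    using jk by (intro arg_cong[of _ _ card]) (auto simp: S_def)
  also have "\<dots> = card {p. p \<le> j \<and> w ! p = a} + card S"
    using finS by (intro card_Un_disjoint) (auto simp: S_def)
  finally have count: "count_list (take (k + 1) w) a = count_list (take (j + 1) w) a + card S"
    by (simp only: count_list_take[OF jk(2)] count_list_take[OF less_trans[OF jk]])
  have "card {j} \<le> card {p. p \<le> j \<and> w ! p = a}" using a by (intro card_mono) auto
  then have "1 \<le> count_list (take (j + 1) w) a"
    by (simp only: count_list_take[OF less_trans[OF jk]]) simp
  then obtain x where x: "count_list (take (j + 1) w) a = Suc x" by (cases "count_list (take (j + 1) w) a") auto
  have "x mod 3 = (x + card S) mod 3" using c unfolding count x by simp
  then have "card S mod 3 = 0" by arith
  moreover have "k \<in> S" using jk a by (simp add: S_def)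
  then have "0 < card S" using finS by (auto simp: card_gt_0_iff)
  ultimately have "3 \<le> card S" by (metis mod_less not_less less_numeral_extra(3))
  moreover have "card (insert j S) = card S + 1" using finS by (simp add: S_def)
  moreover have "card (insert j S) \<le> (k - j) div (n - 1) + 1"
  proof (rule spaced_card)
    fix p p' assume "p \<in> insert j S" "p' \<in> insert j S" "p < p'"
    then show "p + (n - 1) \<le> p'"
      using jk a n by (intro letter_gap[OF w]) (auto simp: S_def)
  qed (use n jk in \<open>auto simp: S_def\<close>)
  ultimately have "3 \<le> (k - j) div (n - 1)" by linarith
  then have "3 * (n - 1) \<le> (k - j) div (n - 1) * (n - 1)" by (rule mult_le_mono1)
  also have "\<dots> \<le> k - j" by (rule div_times_less_eq_dividend)
  finally have "3 * (n - 1) \<le> k - j" .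
  then show ?thesis using jk by linarith
qed

lemma per_sublist:
  assumes "sublist x z"
  shows "per x \<le> per z"
proof -
  obtain ps ss where z: "z = ps @ x @ ss" using assms by (auto simp: sublist_def)
  have nth: "x ! s = z ! (length ps + s)" if "s < length x" for s
    using that unfolding z by (simp add: nth_append)
  have len: "length ps + length x \<le> length z" unfolding z by simp
  show ?thesis
  proof (rule per_le)
    show "1 \<le> per z" using per_period[of z] by (rule conjunct1)
    fix i assume i: "i + per z < length x"
    then have "z ! (length ps + i) = z ! (length ps + i + per z)"
      using conjunct2[OF per_period[of z], rule_format, of "length ps + i"] len by linarith
    then show "x ! i = x ! (i + per z)"
      using nth[of i] nth[of "i + per z"] i by (metis add.assoc add_lessD1)
  qed
qed

lemma D3_bound:
  assumes "w \<in> D3_words \<epsilon> A n" "sublist z w" "z \<noteq> []" "3 * n - 3 \<le> per z" "length z = per z + m" "2 \<le> n"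
  shows "(real m + \<epsilon>) * (real n - 1) \<le> real (per z)"
proof -
  have "1 \<le> per z" using per_period by blast
  moreover have "(real (length z) + \<epsilon>) / real (per z) \<le> real n / (real n - 1)"
    using assms by (auto simp: D3_words_def)
  ultimately show ?thesis using exponent_le_iff[of n "per z" "length z" m \<epsilon>] assms by simp
qed

text \<open>Since \<open>x\<close> has no period below \<open>L\<close>, the repetition formed by \<open>x\<close> and the
common prefix has least period exactly \<open>L\<close>. Hence the bound with \<open>\<epsilon>\<close> applies although
nothing is known about the size of \<open>\<epsilon>\<close> at this point.\<close>

lemma common_pref_bound:
  assumes D: "x @ y \<in> D3_words \<epsilon> A n" and L: "length x = L" "length y = L" "per x = L" "3 * n - 3 \<le> L" "1 \<le> L"
    and n: "2 \<le> n" and m: "common_pref m x y"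
  shows "(real m + \<epsilon>) * (real n - 1) \<le> real L"
proof -
  let ?z = "x @ take m y"
  have m': "m \<le> L" "take m x = take m y" using m L by (auto simp: common_pref_def)
  have nth: "x ! i = y ! i" if "i < m" for i using m' that by (metis nth_take)
  have "per ?z \<le> L"
    using L m' nth by (intro per_le) (auto simp: nth_append)
  moreover have "per x \<le> per ?z" by (rule per_sublist) simp
  ultimately have per: "per ?z = L" using L by simp
  have "(real m + \<epsilon>) * (real n - 1) \<le> real (per ?z)"
  proof (rule D3_bound[OF D])
    have "x @ y = [] @ ?z @ drop m y" by simp
    then show "sublist ?z (x @ y)" by (metis sublist_appendI)
  qed (use L m' n per in auto)
  then show ?thesis using per by simp
qed

lemma common_suff_bound:
  assumes D: "x @ y \<in> D3_words \<epsilon> A n" and L: "length x = L" "length y = L" "per y = L" "3 * n - 3 \<le> L" "1 \<le> L"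
    and n: "2 \<le> n" and m: "common_suff m x y"
  shows "(real m + \<epsilon>) * (real n - 1) \<le> real L"
proof -
  let ?z = "suff m x @ y"
  have m': "m \<le> L" "drop (L - m) x = drop (L - m) y" using m L by (auto simp: common_suff_def suff_def)
  have z: "?z = drop (L - m) y @ y" using m' L by (simp add: suff_def)
  have "per ?z \<le> L"
    unfolding z
  proof (rule per_le)
    fix i assume "i + L < length (drop (L - m) y @ y)"
    then have "i < m" "L - m + i < L" "i + L - m = L - m + i" using L m' by simp_all
    then show "(drop (L - m) y @ y) ! i = (drop (L - m) y @ y) ! (i + L)"
      using L m' by (simp add: nth_append)
  qed (use L in simp)
  moreover have "per y \<le> per ?z" by (rule per_sublist) simp
  ultimately have per: "per ?z = L" using L by simp
  have "(real m + \<epsilon>) * (real n - 1) \<le> real (per ?z)"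
  proof (rule D3_bound[OF D])
    have "x @ y = take (length x - m) x @ ?z @ []" by (simp add: suff_def)
    then show "sublist ?z (x @ y)" by (metis sublist_appendI)
    show "?z \<noteq> []" using L by auto
    show "3 * n - 3 \<le> per ?z" using L per by simp
    show "length ?z = per ?z + m" unfolding per using L m' by (simp add: suff_def)
  qed (rule n)
  then show ?thesis using per by simp
qed

theorem mainTheorem2:
  fixes L n :: nat
    and A :: "'a set"
    and V :: "'a list set"
    and Va :: "'a \<Rightarrow> 'a list set"
    and v :: "'a \<Rightarrow> nat \<Rightarrow> 'a list"
    and \<epsilon> :: real
  assumes n: "n \<ge> 5"
    and L: "L \<ge> 6 * (n - 1)"
    and alphabet: "finite A" "card A = n"
    and V_words: "V \<subseteq> {w \<in> lists A. length w = L}"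
    and V_card: "card V = 3 * n"
    and Va: "\<And>a. a \<in> A \<Longrightarrow> Va a = {v a 1, v a 2, v a 3}"
    and Va_card: "\<And>a. a \<in> A \<Longrightarrow> card (Va a) = 3"
    and Va_disjoint: "disjoint_family_on Va A"
    and Va_union: "(\<Union>a\<in>A. Va a) = V"
    and eps: "\<epsilon> = (real (max_pref V) + real (max_suff V)) / (real L - 1)"
    and cond1: "\<And>x. x \<in> V \<Longrightarrow> per x = length x \<and> length x = L"
    and cond2: "\<And>x y. x \<in> V \<Longrightarrow> y \<in> V \<Longrightarrow> x \<noteq> y \<Longrightarrow>
                  x @ y \<in> D3_words \<epsilon> A n \<inter> T_words A n"
    and cond3: "\<And>a x x' u w. a \<in> A \<Longrightarrow> x \<in> Va a \<Longrightarrow> x' \<in> Va a \<Longrightarrow>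
                  u \<in> V - Va a \<Longrightarrow> w \<in> V - Va a \<Longrightarrow> u \<noteq> w \<Longrightarrow>
                  \<epsilon> + real (Max {l + r | l r. common_pref l u x \<and> common_suff r x' w})
                    \<le> real L / (real n - 1)"
  shows "\<forall>w \<in> D3_words \<epsilon> A n \<inter> T_words A n.
           ctx_subst v [] w \<in> D3_words \<epsilon> A n \<inter> T_words A n"
proof
  let ?DT = "D3_words \<epsilon> A n \<inter> T_words A n"
  have n1: "real n - 1 \<ge> 4" using n by simp
  have L24: "24 \<le> L" using L n by linarith
  have finV: "finite V" using V_card n by (intro card_ge_0_finite) simp
  have lenV: "length x = L" if "x \<in> V" for x using cond1[OF that] by simp
  have other: "\<exists>y\<in>V. y \<noteq> x" for x
  proof (rule ccontr)
    assume "\<not> (\<exists>y\<in>V. y \<noteq> x)"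
    then have "V \<subseteq> {x}" by auto
    then have "card V \<le> 1" using card_mono[of "{x}" V] by simp
    then show False using V_card n by simp
  qed
  define P where "P = {m. \<exists>u\<in>V. \<exists>v\<in>V. u \<noteq> v \<and> common_pref m u v}"
  define S where "S = {m. \<exists>u\<in>V. \<exists>v\<in>V. u \<noteq> v \<and> common_suff m u v}"
  have P: "P \<subseteq> {..L}" and S: "S \<subseteq> {..L}"
    using lenV by (auto simp: P_def S_def common_pref_def common_suff_def)
  have finP: "finite P" and finS: "finite S" using P S finite_subset by blast+
  obtain x0 y0 where xy0: "x0 \<in> V" "y0 \<in> V" "x0 \<noteq> y0" using other by metis
  then have "0 \<in> P" "0 \<in> S"
    using lenV by (auto simp: P_def S_def common_pref_def common_suff_def suff_def)
  then have "Max P \<in> P" "Max S \<in> S" using finP finS by (auto intro: Max_in)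
  then have inP: "max_pref V \<in> P" and inS: "max_suff V \<in> S"
    by (simp_all add: max_pref_def max_suff_def P_def S_def)
  have L3: "3 * n - 3 \<le> L" using L by linarith
  have pref: "(real (max_pref V) + \<epsilon>) * (real n - 1) \<le> real L"
  proof -
    obtain x y where "x \<in> V" "y \<in> V" "x \<noteq> y" "common_pref (max_pref V) x y"
      using inP by (auto simp: P_def)
    then show ?thesis using cond2 cond1 L3 L24 n by (intro common_pref_bound[of x y]) auto
  qed
  have suff: "(real (max_suff V) + \<epsilon>) * (real n - 1) \<le> real L"
  proof -
    obtain x y where "x \<in> V" "y \<in> V" "x \<noteq> y" "common_suff (max_suff V) x y"
      using inS by (auto simp: S_def)
    then show ?thesis using cond2 cond1 L3 L24 n by (intro common_suff_bound[of x y]) auto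
  qed
  have eps': "real (max_pref V) + real (max_suff V) = \<epsilon> * (real L - 1)"
    using eps L24 by simp
  have eps0: "0 \<le> \<epsilon>" using eps L24 by simp
  \<comment> \<open>The definition of \<open>\<epsilon>\<close> turns the two bounds above, added up, into a bound on \<open>\<epsilon>\<close> itself.\<close>
  have "(\<epsilon> * (real n - 1)) * (real L + 1)
      = (real (max_pref V) + \<epsilon>) * (real n - 1) + (real (max_suff V) + \<epsilon>) * (real n - 1)"
  proof -
    have "(\<epsilon> * (real n - 1)) * (real L + 1) = (\<epsilon> * (real L - 1) + 2 * \<epsilon>) * (real n - 1)"
      by (simp add: algebra_simps)
    then show ?thesis unfolding eps'[symmetric] by (simp add: algebra_simps)
  qed
  also have "\<dots> \<le> real L + real L" by (rule add_mono[OF pref suff])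
  also have "\<dots> \<le> 2 * (real L + 1)" by simp
  finally have eps2: "\<epsilon> * (real n - 1) \<le> 2"
    by (rule mult_right_le_imp_le) simp
  have "\<epsilon> * 4 \<le> \<epsilon> * (real n - 1)" using eps0 n1 by (intro mult_left_mono) auto
  then have eps1: "\<epsilon> < 1" using eps2 by simp
  have DT: "x \<in> ?DT \<longleftrightarrow> x \<in> lists A \<and> low_rep n \<epsilon> x" for x
    using n eps1 by (intro mem_DT_iff) auto

  interpret block_code n L V \<epsilon> "max_pref V" "max_suff V"
  proof unfold_locales
    show "\<exists>s. s + p < L \<and> x ! s \<noteq> x ! (s + p)" if "x \<in> V" "1 \<le> p" "p < L" for x p
    proof (rule ccontr)
      assume "\<not> ?thesis"
      then have "per x \<le> p" using that lenV by (intro per_le) auto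
      then show False using cond1[OF that(1)] that by simp
    qed
    show "low_rep n \<epsilon> (x @ y)" if "x \<in> V" "y \<in> V" "x \<noteq> y" for x y
      using cond2[OF that] DT by blast
    show "t \<le> max_pref V"
      if "x \<in> V" "y \<in> V" "x \<noteq> y" "t \<le> L" "\<And>s. s < t \<Longrightarrow> x ! s = y ! s" for x y t
    proof -
      have "take t x = take t y" using that lenV by (intro nth_equalityI) auto
      then have "t \<in> P" unfolding P_def common_pref_def using that lenV by auto
      then show ?thesis using finP by (auto simp: max_pref_def P_def intro: Max_ge)
    qed
    show "t \<le> max_suff V"
      if "x \<in> V" "y \<in> V" "x \<noteq> y" "t \<le> L"
        "\<And>s. s < t \<Longrightarrow> x ! (L - t + s) = y ! (L - t + s)" for x y t
    proof -
      have "drop (L - t) x = drop (L - t) y" using that lenV by (intro nth_equalityI) auto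
      then have "t \<in> S" unfolding S_def common_suff_def suff_def using that lenV by auto
      then show ?thesis using finS by (auto simp: max_suff_def S_def intro: Max_ge)
    qed
    show "length x = L" if "x \<in> V" for x using lenV[OF that] .
  qed (fact n L eps0 eps2 eps')+

  have v_in: "v a (c mod 3 + 1) \<in> Va a" if "a \<in> A" for a c
  proof -
    have "c mod 3 + 1 = 1 \<or> c mod 3 + 1 = 2 \<or> c mod 3 + 1 = 3" by linarith
    then show ?thesis unfolding Va[OF that] by (elim disjE) (simp_all only: insert_iff simp_thms)
  qed
  have Va_eq: "a = b" if "a \<in> A" "b \<in> A" "x \<in> Va a" "x \<in> Va b" for a b x
    using Va_disjoint that unfolding disjoint_family_on_def by blast
  have v_inj: "c mod 3 = c' mod 3"
    if a: "a \<in> A" and e: "v a (c mod 3 + 1) = v a (c' mod 3 + 1)" for a and c c' :: nat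
  proof -
    have "card {v a 1, v a 2, v a 3} = 3" using Va_card[OF a] Va[OF a] by simp
    then have d: "v a 1 \<noteq> v a 2" "v a 1 \<noteq> v a 3" "v a 2 \<noteq> v a 3"
      by (auto simp: card_insert_if split: if_splits)
    have "x = y" if "v a x = v a y" "x = 1 \<or> x = 2 \<or> x = 3" "y = 1 \<or> y = 2 \<or> y = 3" for x y
      using that d by metis
    from this[OF e] have "c mod 3 + 1 = c' mod 3 + 1" by linarith
    then show ?thesis by simp
  qed

  fix w assume "w \<in> ?DT"
  then have wA: "w \<in> lists A" and w: "low_rep n \<epsilon> w" using DT by auto
  define cnt where "cnt j = count_list (take (j + 1) w) (w ! j) - 1" for j
  define B where "B j = v (w ! j) (cnt j mod 3 + 1)" for j
  define W where "W = ctx_subst v [] w"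
  have W: "W = concat (map B [0..<length w])"
    by (simp add: W_def ctx_subst_concat B_def[abs_def] cnt_def[abs_def])
  have letter: "w ! j \<in> A" if "j < length w" for j using wA that by (auto simp: in_lists_conv_set)
  have B_Va: "B j \<in> Va (w ! j)" if "j < length w" for j
    using v_in[OF letter[OF that]] by (simp add: B_def)
  have B_V: "B j \<in> V" if "j < length w" for j using B_Va letter that Va_union by blast
  have B_letter: "w ! j = w ! k" if "j < length w" "k < length w" "B j = B k" for j k
    using Va_eq letter B_Va that by metis
  have far: "j + 3 * (n - 1) \<le> k" if jk: "j < k" "k < length w" and e: "B j = B k" for j k
  proof (rule same_counter_gap[OF w _ jk refl])
    show l: "w ! k = w ! j"
      by (rule B_letter[symmetric]) (use jk e in auto)
    have "cnt j mod 3 = cnt k mod 3"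
      using v_inj[of "w ! j" "cnt j" "cnt k"] e l letter jk by (simp add: B_def)
    then show "(count_list (take (j + 1) w) (w ! j) - 1) mod 3 = (count_list (take (k + 1) w) (w ! j) - 1) mod 3"
      unfolding cnt_def l .
  qed (use n in simp)
  interpret coded_word n L V \<epsilon> "max_pref V" "max_suff V" "length w" B W
  proof unfold_locales
    have concat_len: "length (concat (map B xs)) = length xs * L" if "set xs \<subseteq> {..<length w}" for xs
      using that by (induction xs) (simp_all add: B_V lenV)
    have "length (concat (map B [0..<length w])) = length [0..<length w] * L"
      by (rule concat_len) auto
    then show "length W = length w * L" by (simp add: W)
    show "W ! (j * L + e) = B j ! e" if "j < length w" "e < L" for j e
    proof -
      have "concat (map B [0..<length w]) ! (j * L + e) = map B [0..<length w] ! j ! e"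
      proof (rule nth_concat_uniform)
        show "length x = L" if "x \<in> set (map B [0..<length w])" for x
        proof -
          from that obtain k where "k < length w" "x = B k" by auto
          then show ?thesis by (simp add: B_V lenV)
        qed
      qed (use that in simp_all)
      then show ?thesis using that by (simp add: W)
    qed
    show "j + 3 * (n - 1) \<le> k" if "j < k" "k < length w" "B j = B k" for j k
      using far that .
    show "(real m + \<epsilon>) * (real n - 1) \<le> real k"
      if k: "1 \<le> k" "1 \<le> m" "j + k + m \<le> length w"
        and e: "\<And>s. s < m \<Longrightarrow> B (j + s) = B (j + k + s)" for j k m
    proof -
      have "w ! (j + s) = w ! (j + k + s)" if "s < m" for s
        by (rule B_letter[OF _ _ e[OF that]]) (use that k in linarith)+
      then have "rep w j k m" unfolding rep_def using k by blast
      moreover have "3 * n - 3 \<le> k" using far[of j "j + k"] e[of 0] k by auto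
      ultimately show ?thesis using w unfolding low_rep_def by blast
    qed
    show "(real (a + b) + \<epsilon>) * (real n - 1) \<le> real L"
      if j: "j + 2 < length w" and ab: "a \<le> L" "b \<le> L"
        and sa: "\<And>s. s < a \<Longrightarrow> B j ! (L - a + s) = B (j + 1) ! (L - a + s)"
        and pb: "\<And>s. s < b \<Longrightarrow> B (j + 1) ! s = B (j + 2) ! s" for j a b
    proof -
      let ?M = "{l + r | l r. common_pref l (B (j + 2)) (B (j + 1)) \<and> common_suff r (B (j + 1)) (B j)}"
      \<comment> \<open>Three consecutive letters differ, so the outer blocks are outside the class of the middle one.\<close>
      have apart: "w ! p \<noteq> w ! q" if "p < q" "q \<le> p + 2" "q < length w" for p q
        using letter_gap[OF w _ that(1,3)] that(2) n by auto
      have V3: "B j \<in> V" "B (j + 1) \<in> V" "B (j + 2) \<in> V" using B_V j by auto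
      have "drop (L - a) (B (j + 1)) = drop (L - a) (B j)"
        using sa V3 lenV ab by (intro nth_equalityI) auto
      then have 1: "common_suff a (B (j + 1)) (B j)"
        using V3 lenV ab by (simp add: common_suff_def suff_def)
      have "take b (B (j + 2)) = take b (B (j + 1))"
        using pb V3 lenV ab by (intro nth_equalityI) auto
      then have 2: "common_pref b (B (j + 2)) (B (j + 1))"
        using V3 lenV ab by (simp add: common_pref_def)
      have "?M \<subseteq> {..L + L}"
        using V3 lenV by (auto simp: common_pref_def common_suff_def intro!: add_mono)
      then have "finite ?M" by (rule finite_subset) simp
      then have "b + a \<le> Max ?M" using 1 2 by (intro Max_ge) auto
      moreover have "\<epsilon> + real (Max ?M) \<le> real L / (real n - 1)"
      proof (rule cond3[of "w ! (j + 1)"])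
        have no: "B q \<notin> Va (w ! (j + 1))" if "q < length w" "w ! q \<noteq> w ! (j + 1)" for q
          using Va_eq[of "w ! q" "w ! (j + 1)" "B q"] that letter B_Va j by auto
        show "B (j + 2) \<in> V - Va (w ! (j + 1))" "B j \<in> V - Va (w ! (j + 1))"
          using no[of j] no[of "j + 2"] apart[of j "j + 1"] apart[of "j + 1" "j + 2"] V3 j by auto
        show "B (j + 2) \<noteq> B j" using B_letter[of "j + 2" j] apart[of j "j + 2"] j by auto
      qed (use letter B_Va j in auto)
      ultimately have "real (a + b) + \<epsilon> \<le> real L / (real n - 1)" by linarith
      then show ?thesis using n1 by (simp add: le_divide_eq)
    qed
    show "B j \<in> V" if "j < length w" for j using B_V that .
    show "\<exists>y\<in>V. y \<noteq> x" for x by (rule other)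
  qed
  have "W \<in> lists A"
  proof -
    have "set (B j) \<subseteq> A" if "j < length w" for j using B_V[OF that] V_words by auto
    then show ?thesis by (fastforce simp: W in_lists_conv_set)
  qed
  then show "ctx_subst v [] w \<in> ?DT"
    unfolding W_def[symmetric] DT using low_rep_W by blast
qed

end
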